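(* Let $d$ be an optimal disclosure rule for the seller in the mandated transparency environment ($\tau=1$), and let $d'$ be an optimal disclosure rule for the seller in the hidden motives environment ($\tau=0$). 1. If $p$ is strictly convex, then the buyer is better informed under mandated transparency, i.e. under $(d,1)$ than under $(d',0)$. 2. If $p$ is strictly concave and $\mathbb E[x|y]=\mathbb E[x]$ for every $y\in\mathcal Y$, then the buyer is better informed in the hidden motives environment, i.e. under $(d',0)$ than under $(d,1)$.
   Context: Let $\mathcal X=[x_{min},x_{max}]$ and $\mathcal Y=[y_{min},y_{max}]$ be nondegenerate compact intervals with $y_{min}\ge 0$. An object has a profitability $y\in\mathcal Y$ to a seller, with marginal cdf $F_Y$. Conditional on $y$, the seller observes a signal realization $x\in\mathcal X$ with cdf $F_{X|y}$; a signal realization is identified with the posterior mean of the object's value to the buyer that it induces, which does not depend on $y$; so $\mathbb E[x|y]$ is the mean of $F_{X|y}$. Standing assumptions: $F_Y$ has full support on $\mathcal Y$ and each $F_{X|y}$ has full support on $\mathcal X$; the joint distribution of $(x,y)$ has no mass points, in the sense that for every $a\in\mathcal X$ and measurable $\varphi:\mathcal X\to\mathbb R$ the event $\{(x-a)(y-\varphi(x))=0\}$ has probability zero. The demand function $p:\mathcal X\to[0,1]$ is strictly increasing and differentiable; $p(\hat x)$ is the probability that the buyer purchases when the buyer's posterior mean is $\hat x$. A disclosure rule is a measurable map $d$ assigning to each $(x,y)\in\mathcal X\times\mathcal Y$ a disclosure probability $d(x,y)\in[0,1]$. If $x$ is disclosed the buyer's posterior mean is $x$. Hidden motives environment ($\tau=0$):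 the buyer does not observe $y$, and after non-disclosure the posterior mean is $$x^{ND}(d)=\frac{\int_{\mathcal Y}\int_{\mathcal X}x(1-d(x,y))\,dF_{X|y}(x)\,dF_Y(y)}{\int_{\mathcal Y}\int_{\mathcal X}(1-d(x,y))\,dF_{X|y}(x)\,dF_Y(y)}$$ (fixed at some value in $\mathcal X$ if the denominator is zero). An optimal rule maximizes $\int_{\mathcal Y}y\int_{\mathcal X}[d(x,y)p(x)+(1-d(x,y))p(x^{ND}(d))]\,dF_{X|y}(x)\,dF_Y(y)$ over disclosure rules. Mandated transparency environment ($\tau=1$): the buyer also observes $y$, and after non-disclosure at profitability $y$ the posterior mean is $$x^{ND}_y(d)=\frac{\int_{\mathcal X}x(1-d(x,y))\,dF_{X|y}(x)}{\int_{\mathcal X}(1-d(x,y))\,dF_{X|y}(x)}$$ (fixed at some value in $\mathcal X$ if the denominator is zero). An optimal rule maximizes $\int_{\mathcal Y}y\int_{\mathcal X}[d(x,y)p(x)+(1-d(x,y))p(x^{ND}_y(d))]\,dF_{X|y}(x)\,dF_Y(y)$ over disclosure rules. For a rule $d$ and $\tau\in\{0,1\}$, $F^B(\cdot,d,\tau)$ is the cdf of the buyer's posterior mean: it equals $x$ when $x$ is disclosed, and, when the realization is not disclosed at profitability $y$, equals $x^{ND}(d)$ if $\tau=0$ and $x^{ND}_y(d)$ if $\tau=1$. The buyer is better informed under $(d_1,\tau_1)$ than under $(d_2,\tau_2)$ if $F^B(\cdot,d_1,\tau_1)$ is a (weak) mean-preserving spread of $F^B(\cdot,d_2,\tau_2)$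 (equivalently, Blackwell more informative). *)

theory Defs
  imports "HOL-Probability.Probability"
begin

definition strictly_convex_on :: "real set \<Rightarrow> (real \<Rightarrow> real) \<Rightarrow> bool" where
  "strictly_convex_on S f \<longleftrightarrow> convex S \<and>
     (\<forall>x\<in>S. \<forall>y\<in>S. \<forall>u\<in>{0<..<1}. x \<noteq> y \<longrightarrow>
        f ((1 - u) * x + u * y) < (1 - u) * f x + u * f y)"

definition strictly_concave_on :: "real set \<Rightarrow> (real \<Rightarrow> real) \<Rightarrow> bool" where
  "strictly_concave_on S f \<longleftrightarrow> strictly_convex_on S (\<lambda>x. - f x)"

text \<open>
  \<open>F\<close> and \<open>G\<close> are cdfs of distributions concentrated on \<open>{a..b}\<close>, and \<open>F\<close> is a weak
  mean-preserving spread of \<open>G\<close>.  The mean of such a distribution is \<open>b\<close> minus the integral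
  of its cdf over \<open>{a..b}\<close>, so the second conjunct says that the means agree.
\<close>

definition mean_preserving_spread ::
  "real \<Rightarrow> real \<Rightarrow> (real \<Rightarrow> real) \<Rightarrow> (real \<Rightarrow> real) \<Rightarrow> bool" where
  "mean_preserving_spread a b F G \<longleftrightarrow>
     (\<forall>t\<in>{a..b}. integral {a..t} G \<le> integral {a..t} F) \<and>
     integral {a..b} F = integral {a..b} G"

text \<open>
  \<open>FY\<close> is a probability measure on the Borel sets of \<open>{ymin..ymax}\<close>, and \<open>FX\<close> is a Markov
  kernel from there to the Borel sets of \<open>{xmin..xmax}\<close>.
\<close>

definition joint_distribution ::
  "real set \<Rightarrow> real set \<Rightarrow> real measure \<Rightarrow> (real \<Rightarrow> real measure) \<Rightarrow> (real \<times> real) measure" where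
  "joint_distribution X Y FY FX =
     FY \<bind> (\<lambda>y. FX y \<bind>
       (\<lambda>x. return (restrict_space borel X \<Otimes>\<^sub>M restrict_space borel Y) (x, y)))"

definition full_support_on :: "real set \<Rightarrow> real measure \<Rightarrow> bool" where
  "full_support_on S M \<longleftrightarrow> (\<forall>U. open U \<and> U \<inter> S \<noteq> {} \<longrightarrow> measure M (U \<inter> S) > 0)"

text \<open>
  \<open>c0\<close> and \<open>c1 y\<close> are the posterior means after an off-path non-disclosure (zero denominator)
  when the buyer does not, respectively does, observe \<open>y\<close>.
\<close>

locale disclosure_setting =
  fixes xmin xmax ymin ymax :: real
    and FY :: "real measure" and FX :: "real \<Rightarrow> real measure"
    and p :: "real \<Rightarrow> real"
    and c0 :: real and c1 :: "real \<Rightarrow> real"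
  assumes x_nondegenerate: "xmin < xmax"
    and y_nondegenerate: "ymin < ymax"
    and y_nonneg: "0 \<le> ymin"
    and FY_prob: "FY \<in> space (prob_algebra (restrict_space borel {ymin..ymax}))"
    and FX_kernel: "FX \<in> restrict_space borel {ymin..ymax} \<rightarrow>\<^sub>M
                           prob_algebra (restrict_space borel {xmin..xmax})"
    and FY_full_support: "full_support_on {ymin..ymax} FY"
    and FX_full_support: "\<And>y. y \<in> {ymin..ymax} \<Longrightarrow> full_support_on {xmin..xmax} (FX y)"
    and no_mass_points:
      "\<And>a \<phi>. a \<in> {xmin..xmax} \<Longrightarrow> \<phi> \<in> borel_measurable (restrict_space borel {xmin..xmax}) \<Longrightarrow>
         measure (joint_distribution {xmin..xmax} {ymin..ymax} FY FX)
           {(x, y) \<in> {xmin..xmax} \<times> {ymin..ymax}. (x - a) * (y - \<phi> x) = 0} = 0"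
    and p_range: "p ` {xmin..xmax} \<subseteq> {0..1}"
    and p_strict_mono: "strict_mono_on {xmin..xmax} p"
    and p_differentiable: "p differentiable_on {xmin..xmax}"
    and c0_range: "c0 \<in> {xmin..xmax}"
    and c1_range: "\<And>y. y \<in> {ymin..ymax} \<Longrightarrow> c1 y \<in> {xmin..xmax}"

definition disclosure_rule :: "real set \<Rightarrow> real set \<Rightarrow> (real \<Rightarrow> real \<Rightarrow> real) \<Rightarrow> bool" where
  "disclosure_rule X Y d \<longleftrightarrow>
     (\<lambda>(x, y). d x y) \<in> borel_measurable (restrict_space borel X \<Otimes>\<^sub>M restrict_space borel Y) \<and>
     (\<forall>x\<in>X. \<forall>y\<in>Y. d x y \<in> {0..1})"

datatype regime = Hidden_Motives | Mandated_Transparency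

definition nd_mean_hidden ::
  "real measure \<Rightarrow> (real \<Rightarrow> real measure) \<Rightarrow> real \<Rightarrow> (real \<Rightarrow> real \<Rightarrow> real) \<Rightarrow> real" where
  "nd_mean_hidden FY FX c0 d =
     (let q = (\<integral>y. (\<integral>x. (1 - d x y) \<partial>FX y) \<partial>FY)
      in if q = 0 then c0 else (\<integral>y. (\<integral>x. x * (1 - d x y) \<partial>FX y) \<partial>FY) / q)"

definition nd_mean_transparent ::
  "(real \<Rightarrow> real measure) \<Rightarrow> (real \<Rightarrow> real) \<Rightarrow> (real \<Rightarrow> real \<Rightarrow> real) \<Rightarrow> real \<Rightarrow> real" where
  "nd_mean_transparent FX c1 d y =
     (let q = (\<integral>x. (1 - d x y) \<partial>FX y)
      in if q = 0 then c1 y else (\<integral>x. x * (1 - d x y) \<partial>FX y) / q)"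

fun nd_mean ::
  "real measure \<Rightarrow> (real \<Rightarrow> real measure) \<Rightarrow> real \<Rightarrow> (real \<Rightarrow> real) \<Rightarrow> regime \<Rightarrow>
   (real \<Rightarrow> real \<Rightarrow> real) \<Rightarrow> real \<Rightarrow> real" where
  "nd_mean FY FX c0 c1 Hidden_Motives d y = nd_mean_hidden FY FX c0 d"
| "nd_mean FY FX c0 c1 Mandated_Transparency d y = nd_mean_transparent FX c1 d y"

definition seller_payoff ::
  "real measure \<Rightarrow> (real \<Rightarrow> real measure) \<Rightarrow> (real \<Rightarrow> real) \<Rightarrow> real \<Rightarrow> (real \<Rightarrow> real) \<Rightarrow> regime \<Rightarrow>
   (real \<Rightarrow> real \<Rightarrow> real) \<Rightarrow> real" where
  "seller_payoff FY FX p c0 c1 \<tau> d =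
     (\<integral>y. y * (\<integral>x. (d x y * p x + (1 - d x y) * p (nd_mean FY FX c0 c1 \<tau> d y)) \<partial>FX y) \<partial>FY)"

definition optimal_rule ::
  "real set \<Rightarrow> real set \<Rightarrow> real measure \<Rightarrow> (real \<Rightarrow> real measure) \<Rightarrow> (real \<Rightarrow> real) \<Rightarrow>
   real \<Rightarrow> (real \<Rightarrow> real) \<Rightarrow> regime \<Rightarrow> (real \<Rightarrow> real \<Rightarrow> real) \<Rightarrow> bool" where
  "optimal_rule X Y FY FX p c0 c1 \<tau> d \<longleftrightarrow>
     disclosure_rule X Y d \<and>
     (\<forall>e. disclosure_rule X Y e \<longrightarrow>
        seller_payoff FY FX p c0 c1 \<tau> e \<le> seller_payoff FY FX p c0 c1 \<tau> d)"

text \<open>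
  The cdf of the buyer's posterior mean: given \<open>(x, y)\<close>, the posterior mean is \<open>x\<close> with
  probability \<open>d x y\<close> and the non-disclosure mean with probability \<open>1 - d x y\<close>.
\<close>

definition buyer_cdf ::
  "real measure \<Rightarrow> (real \<Rightarrow> real measure) \<Rightarrow> real \<Rightarrow> (real \<Rightarrow> real) \<Rightarrow> (real \<Rightarrow> real \<Rightarrow> real) \<Rightarrow>
   regime \<Rightarrow> real \<Rightarrow> real" where
  "buyer_cdf FY FX c0 c1 d \<tau> t =
     (\<integral>y. (\<integral>x. (d x y * indicator {..t} x
                + (1 - d x y) * indicator {..t} (nd_mean FY FX c0 c1 \<tau> d y)) \<partial>FX y) \<partial>FY)"

definition better_informed ::
  "real \<Rightarrow> real \<Rightarrow> real measure \<Rightarrow> (real \<Rightarrow> real measure) \<Rightarrow> real \<Rightarrow> (real \<Rightarrow> real) \<Rightarrow>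
   (real \<Rightarrow> real \<Rightarrow> real) \<times> regime \<Rightarrow> (real \<Rightarrow> real \<Rightarrow> real) \<times> regime \<Rightarrow> bool" where
  "better_informed xmin xmax FY FX c0 c1 s1 s2 \<longleftrightarrow>
     mean_preserving_spread xmin xmax
       (buyer_cdf FY FX c0 c1 (fst s1) (snd s1)) (buyer_cdf FY FX c0 c1 (fst s2) (snd s2))"

end

theory Submission
  imports Defs
begin

text \<open>
  Under transparency the seller solves a separate persuasion problem for each \<open>y\<close>.  By the
  equality case of Jensen's inequality (through a tangent line of \<open>p\<close>), the buyer's posterior
  mean under an optimal rule is almost surely \<open>x\<close> if \<open>p\<close> is strictly convex and almost surely
  \<open>\<integral>x. x \<partial>FX y\<close> if \<open>p\<close> is strictly concave; the case \<open>y = 0\<close>, where the seller is indifferent, has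
  probability zero.  So the buyer learns as much as under full disclosure in the first case and,
  the conditional means being equal, nothing in the second.  Any rule under hidden motives is
  between these extremes: the integral of the cdf of the posterior mean up to \<open>t\<close> is the
  expectation of its shortfall below \<open>t\<close>, a convex function.
\<close>

subsection \<open>Tangents, weighted means and integrated cdfs\<close>

text \<open>By convexity, difference quotients from \<open>m\<close> towards \<open>z\<close> are at
  most \<open>f z - f m\<close>, so in the limit the tangent lies weakly below \<open>f\<close>; the
  midpoint makes this strict. The derivative is taken within \<open>S\<close> because
  \<open>m\<close> may be an endpoint.\<close>

lemma strictly_convex_above_tangent:
  fixes f :: "real \<Rightarrow> real"
  assumes conv: "strictly_convex_on S f" and m: "m \<in> S" and x: "x \<in> S" "x \<noteq> m"
    and deriv: "(f has_real_derivative D) (at m within S)"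
  shows "f m + D * (x - m) < f x"
proof -
  have S: "convex S" and strict: "\<And>x y u. x \<in> S \<Longrightarrow> y \<in> S \<Longrightarrow> 0 < u \<Longrightarrow> u < 1 \<Longrightarrow> x \<noteq> y \<Longrightarrow>
        f ((1 - u) * x + u * y) < (1 - u) * f x + u * f y"
    using conv by (auto simp: strictly_convex_on_def)
  have weak: "D * (z - m) \<le> f z - f m" if z: "z \<in> S" "z \<noteq> m" for z
  proof -
    have mem: "m + u * (z - m) \<in> S" if "u \<in> {0..1}" for u
      using convexD_alt[OF S m z(1), of u] that by (simp add: algebra_simps)
    have "((\<lambda>u. f (m + u * (z - m))) has_real_derivative D * (z - m)) (at 0 within {0..1})"
    proof -
      have "(f has_real_derivative D) (at (m + 0 * (z - m)) within (\<lambda>u. m + u * (z - m)) ` {0..1})"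
        unfolding mult_zero_left add_0_right by (rule DERIV_subset[OF deriv]) (use mem in blast)
      moreover have "((\<lambda>u. m + u * (z - m)) has_real_derivative z - m) (at 0 within {0..1})"
        by (auto intro!: derivative_eq_intros)
      ultimately show ?thesis
        using DERIV_image_chain[of f D "\<lambda>u. m + u * (z - m)"] by (simp add: o_def)
    qed
    then have lim: "((\<lambda>u. (f (m + u * (z - m)) - f m) / u) \<longlongrightarrow> D * (z - m)) (at 0 within {0..1})"
      by (simp add: has_field_derivative_iff)
    have "\<forall>\<^sub>F u in at 0 within {0..1}. (f (m + u * (z - m)) - f m) / u \<le> f z - f m"
      unfolding eventually_at
    proof (intro exI[of _ 1] conjI ballI impI)
      fix u :: real assume u: "u \<in> {0..1}" "u \<noteq> 0 \<and> dist u 0 < 1"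
      then have "f ((1 - u) * m + u * z) < (1 - u) * f m + u * f z"
        using strict[of m z u] m z by (auto simp: dist_real_def)
      moreover have "(1 - u) * m + u * z = m + u * (z - m)"
        by (simp add: algebra_simps)
      ultimately have "f (m + u * (z - m)) - f m \<le> (f z - f m) * u"
        by (simp add: algebra_simps)
      then show "(f (m + u * (z - m)) - f m) / u \<le> f z - f m"
        using u by (subst pos_divide_le_eq) auto
    qed simp
    moreover have "at (0::real) within {0..1} \<noteq> bot"
      by (simp add: at_within_Icc_at_right)
    ultimately show ?thesis
      using tendsto_upperbound[OF lim] by blast
  qed
  \<comment> \<open>At the midpoint the weak bound carries half the slope term, while strict
    convexity puts \<open>f z\<close> strictly below the average of \<open>f m\<close> and
    \<open>f x\<close>; doubling gives the claim.\<close>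
  define z where "z = (1 - 1/2) * m + (1/2) * x"
  have "z \<in> S"
    unfolding z_def using convexD_alt[OF S m x(1), of "1/2"] by simp
  moreover have "z \<noteq> m"
    using x by (simp add: z_def field_simps)
  ultimately have "D * (z - m) \<le> f z - f m"
    by (rule weak)
  moreover have "f z < (1 - 1/2) * f m + (1/2) * f x"
    unfolding z_def using strict[OF m x(1), of "1/2"] x by simp
  moreover have "D * (z - m) = D * (x - m) / 2"
    by (simp add: z_def field_simps)
  ultimately show ?thesis by simp
qed

text \<open>Fubini: integrating the indicator of \<open>Z z \<le> s\<close> over \<open>s\<close> in
  \<open>{a..t}\<close> leaves the shortfall of \<open>Z z\<close> below \<open>t\<close>. The
  weight is there because a disclosure rule splits the cdf of the posterior mean into a disclosed
  and a pooled part.\<close>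

lemma (in finite_measure) has_integral_weighted_cdf:
  fixes w Z :: "'a \<Rightarrow> real"
  assumes [measurable]: "w \<in> borel_measurable M" "Z \<in> borel_measurable M"
    and w: "\<And>z. z \<in> space M \<Longrightarrow> w z \<in> {0..1}"
    and Z: "\<And>z. z \<in> space M \<Longrightarrow> a \<le> Z z"
  shows "((\<lambda>s. \<integral>z. w z * indicator {..s} (Z z) \<partial>M) has_integral
           (\<integral>z. w z * max 0 (t - Z z) \<partial>M)) {a..t}"
proof -
  interpret pair_sigma_finite M lborel
    by (intro pair_sigma_finite.intro sigma_finite_measure_axioms lborel.sigma_finite_measure_axioms)
  \<comment> \<open>The cut-off to \<open>{a..t}\<close> is built into the integrand:
    \<open>lborel\<close> is infinite, and Fubini needs integrability on the product.\<close>
  define h where "h z s = (if Z z \<le> s \<and> a \<le> s \<and> s \<le> t then w z else 0)" for z s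
  have [measurable]: "case_prod h \<in> borel_measurable (M \<Otimes>\<^sub>M lborel)"
    unfolding h_def by measurable
  have h_eq: "h z s = indicator {a..t} s *\<^sub>R (w z * indicator {..s} (Z z))" for z s
    by (auto simp: h_def indicator_def)
  have "integrable (M \<Otimes>\<^sub>M lborel) (indicator (space M \<times> {a..t}) :: _ \<Rightarrow> real)"
    by (rule integrable_real_indicator)
       (auto simp: lborel.emeasure_pair_measure_Times emeasure_lborel_Icc_eq emeasure_eq_measure ennreal_mult_less_top)
  then have int: "integrable (M \<Otimes>\<^sub>M lborel) (case_prod h)"
    by (rule Bochner_Integration.integrable_bound)
       (use w in \<open>auto simp: h_def space_pair_measure indicator_def intro!: AE_I2 split: if_splits\<close>)
  have inner: "(\<integral>s. h z s \<partial>lborel) = w z * max 0 (t - Z z)" if "z \<in> space M" for z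
  proof -
    \<comment> \<open>As \<open>a \<le> Z z\<close>, the lower cut-off follows from
      \<open>Z z \<le> s\<close>. The remaining interval has length \<open>t - Z z\<close> or is
      empty, whence the \<open>max\<close>.\<close>
    have "h z = (\<lambda>s. w z * indicator {Z z..t} s)"
      using Z[OF that] by (auto simp: h_def indicator_def)
    then have "(\<integral>s. h z s \<partial>lborel) = (\<integral>s. w z * indicator {Z z..t} s \<partial>lborel)"
      by (rule arg_cong)
    then show ?thesis by (simp add: max_def)
  qed
  have ints: "integrable lborel (\<lambda>s. \<integral>z. h z s \<partial>M)"
    by (rule integrable_snd[OF int])
  have "(\<integral>s. (\<integral>z. h z s \<partial>M) \<partial>lborel) = (\<integral>z. (\<integral>s. h z s \<partial>lborel) \<partial>M)"
    by (rule Fubini_integral[OF int])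
  also have "\<dots> = (\<integral>z. w z * max 0 (t - Z z) \<partial>M)"
    by (rule Bochner_Integration.integral_cong) (auto simp: inner)
  finally have "((\<lambda>s. \<integral>z. h z s \<partial>M) has_integral (\<integral>z. w z * max 0 (t - Z z) \<partial>M)) UNIV"
    using has_integral_integral_lborel[OF ints] by simp
  moreover have "(\<lambda>s. \<integral>z. h z s \<partial>M) =
      (\<lambda>s. if s \<in> {a..t} then (\<integral>z. w z * indicator {..s} (Z z) \<partial>M) else 0)"
    by (auto simp: h_eq)
  ultimately show ?thesis
    by (simp only: has_integral_restrict_UNIV)
qed

text \<open>Abstract form of the posterior mean after non-disclosure: \<open>w\<close> is the
  probability of withholding, and \<open>c\<close> the value fixed off path. It is applied both to a
  single \<open>FX y\<close> and to the joint distribution.\<close>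

lemma (in prob_space) weighted_mean:
  fixes w Z :: "'a \<Rightarrow> real"
  assumes [measurable]: "w \<in> borel_measurable M" "Z \<in> borel_measurable M"
    and w: "\<And>z. z \<in> space M \<Longrightarrow> w z \<in> {0..1}"
    and Z: "\<And>z. z \<in> space M \<Longrightarrow> Z z \<in> {a..b}"
    and c: "c \<in> {a..b}"
    and m: "m = (if expectation w = 0 then c else expectation (\<lambda>z. Z z * w z) / expectation w)"
  shows "m \<in> {a..b}" and "expectation (\<lambda>z. w z * (Z z - m)) = 0"
    and "expectation w = 0 \<Longrightarrow> AE z in M. w z = 0"
proof -
  have intw: "integrable M w"
    by (rule integrable_const_bound[of _ 1]) (use w in auto)
  have intZ: "integrable M (\<lambda>z. Z z * w z)"
  proof (rule integrable_const_bound[of _ "max \<bar>a\<bar> \<bar>b\<bar>"])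
    have "\<bar>Z z * w z\<bar> \<le> max \<bar>a\<bar> \<bar>b\<bar>" if "z \<in> space M" for z
    proof -
      have "\<bar>Z z\<bar> * \<bar>w z\<bar> \<le> max \<bar>a\<bar> \<bar>b\<bar> * 1"
        by (rule mult_mono) (use w[OF that] Z[OF that] in auto)
      then show ?thesis by (simp add: abs_mult)
    qed
    then show "AE z in M. norm (Z z * w z) \<le> max \<bar>a\<bar> \<bar>b\<bar>" by auto
  qed simp
  have pos: "0 \<le> expectation w"
    by (rule integral_nonneg_AE) (use w in auto)
  show null: "AE z in M. w z = 0" if "expectation w = 0"
    using that by (subst (asm) integral_nonneg_eq_0_iff_AE[OF intw]) (use w in auto)
  \<comment> \<open>The product form also covers zero total weight, where both sides vanish whatever
    \<open>c\<close> is.\<close>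
  have eq: "m * expectation w = expectation (\<lambda>z. Z z * w z)"
  proof (cases "expectation w = 0")
    case True
    have "expectation (\<lambda>z. Z z * w z) = 0"
      by (rule integral_eq_zero_AE) (use null[OF True] in auto)
    with True show ?thesis by simp
  qed (simp add: m)
  then show "expectation (\<lambda>z. w z * (Z z - m)) = 0"
    using intw intZ by (simp add: algebra_simps)
  show "m \<in> {a..b}"
  proof (cases "expectation w = 0")
    case False
    have "expectation (\<lambda>z. a * w z) \<le> expectation (\<lambda>z. Z z * w z)"
      by (rule integral_mono) (use intw intZ w Z in \<open>auto intro!: mult_right_mono\<close>)
    moreover have "expectation (\<lambda>z. Z z * w z) \<le> expectation (\<lambda>z. b * w z)"
      by (rule integral_mono) (use intw intZ w Z in \<open>auto intro!: mult_right_mono\<close>)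
    ultimately show ?thesis
      using False pos intw by (simp add: m field_simps)
  qed (use c in \<open>simp add: m\<close>)
qed

subsection \<open>The joint distribution of signals and profitability\<close>

context disclosure_setting
begin

abbreviation "X \<equiv> {xmin..xmax}"
abbreviation "Y \<equiv> {ymin..ymax}"
abbreviation "XB \<equiv> restrict_space borel X"
abbreviation "YB \<equiv> restrict_space borel Y"
abbreviation "J \<equiv> joint_distribution X Y FY FX"

sublocale FY: prob_space FY
  using FY_prob by (simp add: space_prob_algebra)

lemma sets_FY [measurable_cong]: "sets FY = sets YB"
  using FY_prob by (simp add: space_prob_algebra)

lemma space_FY: "space FY = Y"
  using sets_eq_imp_space_eq[OF sets_FY] by (simp add: space_restrict_space)

lemma FX_in_prob_algebra: "y \<in> Y \<Longrightarrow> FX y \<in> space (prob_algebra XB)"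
  using measurable_space[OF FX_kernel, of y] by (simp add: space_restrict_space)

lemma prob_space_FX: "y \<in> Y \<Longrightarrow> prob_space (FX y)"
  using FX_in_prob_algebra by (simp add: space_prob_algebra)

lemma sets_FX: "y \<in> Y \<Longrightarrow> sets (FX y) = sets XB"
  using FX_in_prob_algebra by (simp add: space_prob_algebra)

lemma space_FX: "y \<in> Y \<Longrightarrow> space (FX y) = X"
  using sets_eq_imp_space_eq[OF sets_FX] by (simp add: space_restrict_space)

lemma measurable_FX: "y \<in> Y \<Longrightarrow> f \<in> XB \<rightarrow>\<^sub>M N \<Longrightarrow> f \<in> FX y \<rightarrow>\<^sub>M N"
  by (simp cong: measurable_cong_sets add: sets_FX)

lemma measurable_fst_joint [measurable]: "fst \<in> borel_measurable (XB \<Otimes>\<^sub>M YB)"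
  by (rule measurable_compose[OF measurable_fst measurable_restrict_space1]) simp

lemma measurable_snd_joint [measurable]: "snd \<in> borel_measurable (XB \<Otimes>\<^sub>M YB)"
  by (rule measurable_compose[OF measurable_snd measurable_restrict_space1]) simp

text \<open>The inner bind with \<open>return\<close> is the push-forward of \<open>FX y\<close>
  along \<open>x \<mapsto> (x, y)\<close>. In this form the joint law is a single bind of a
  probability kernel, to which the rules for integrals and null sets of binds apply.\<close>

lemma joint_eq_bind_distr: "J = FY \<bind> (\<lambda>y. distr (FX y) (XB \<Otimes>\<^sub>M YB) (\<lambda>x. (x, y)))"
  unfolding joint_distribution_def
proof (rule bind_cong_All, safe)
  fix y assume "y \<in> space FY"
  then have y: "y \<in> Y" by (simp add: space_FY)
  have "(\<lambda>x. (x, y)) \<in> XB \<rightarrow>\<^sub>M XB \<Otimes>\<^sub>M YB"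
    using y by (intro measurable_Pair2') (simp add: space_restrict_space)
  then show "FX y \<bind> (\<lambda>x. return (XB \<Otimes>\<^sub>M YB) (x, y)) = distr (FX y) (XB \<Otimes>\<^sub>M YB) (\<lambda>x. (x, y))"
    by (intro bind_return_distr' prob_space.not_empty[OF prob_space_FX[OF y]] measurable_FX[OF y])
qed

lemma joint_kernel: "(\<lambda>y. distr (FX y) (XB \<Otimes>\<^sub>M YB) (\<lambda>x. (x, y))) \<in> YB \<rightarrow>\<^sub>M prob_algebra (XB \<Otimes>\<^sub>M YB)"
  by (rule measurable_distr_prob_space2[OF FX_kernel]) measurable

lemma joint_kernel_FY:
  "(\<lambda>y. distr (FX y) (XB \<Otimes>\<^sub>M YB) (\<lambda>x. (x, y))) \<in> FY \<rightarrow>\<^sub>M prob_algebra (XB \<Otimes>\<^sub>M YB)"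
  using joint_kernel by (simp cong: measurable_cong_sets add: sets_FY)

sublocale J: prob_space J
  unfolding joint_eq_bind_distr by (rule prob_space_bind'[OF FY_prob joint_kernel])

lemma sets_joint [measurable_cong]: "sets J = sets (XB \<Otimes>\<^sub>M YB)"
  unfolding joint_eq_bind_distr by (rule sets_bind'[OF FY_prob joint_kernel])

lemma space_joint: "space J = X \<times> Y"
  using sets_eq_imp_space_eq[OF sets_joint] by (simp add: space_pair_measure space_restrict_space)

lemma integral_joint_slice:
  fixes f :: "real \<Rightarrow> real \<Rightarrow> real"
  assumes "(\<lambda>(x, y). f x y) \<in> borel_measurable (XB \<Otimes>\<^sub>M YB)" and y: "y \<in> Y"
  shows "integral\<^sup>L (distr (FX y) (XB \<Otimes>\<^sub>M YB) (\<lambda>x. (x, y))) (\<lambda>(x, y). f x y) = (\<integral>x. f x y \<partial>FX y)"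
proof -
  have "(\<lambda>x. (x, y)) \<in> FX y \<rightarrow>\<^sub>M XB \<Otimes>\<^sub>M YB"
    using y by (intro measurable_FX measurable_Pair2') (auto simp: space_restrict_space)
  then show ?thesis
    using assms by (simp add: integral_distr)
qed

text \<open>The integral of a fixed measurable function depends measurably on the measure; compose
  this with the kernel of push-forwards.\<close>

lemma borel_measurable_kernel_integral:
  fixes f :: "real \<Rightarrow> real \<Rightarrow> real"
  assumes f: "(\<lambda>(x, y). f x y) \<in> borel_measurable (XB \<Otimes>\<^sub>M YB)"
  shows "(\<lambda>y. \<integral>x. f x y \<partial>FX y) \<in> borel_measurable YB"
proof -
  have "(\<lambda>y. integral\<^sup>L (distr (FX y) (XB \<Otimes>\<^sub>M YB) (\<lambda>x. (x, y))) (\<lambda>(x, y). f x y)) \<in> borel_measurable YB"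
    using f measurable_prob_algebraD[OF joint_kernel]
    by (intro measurable_compose[OF _ integral_measurable_subprob_algebra]) auto
  then show ?thesis
    by (rule measurable_cong[THEN iffD1, rotated])
       (simp add: integral_joint_slice[OF f] space_restrict_space)
qed

lemma integral_joint:
  fixes f :: "real \<Rightarrow> real \<Rightarrow> real"
  assumes f: "(\<lambda>(x, y). f x y) \<in> borel_measurable (XB \<Otimes>\<^sub>M YB)"
    and bound: "\<And>x y. x \<in> X \<Longrightarrow> y \<in> Y \<Longrightarrow> \<bar>f x y\<bar> \<le> B"
  shows "(\<integral>y. (\<integral>x. f x y \<partial>FX y) \<partial>FY) = (\<integral>(x, y). f x y \<partial>J)"
proof -
  have "(\<integral>(x, y). f x y \<partial>J) =
      (\<integral>y. integral\<^sup>L (distr (FX y) (XB \<Otimes>\<^sub>M YB) (\<lambda>x. (x, y))) (\<lambda>(x, y). f x y) \<partial>FY)"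
    unfolding joint_eq_bind_distr
  proof (rule integral_bind[where B = B and B' = 1])
    \<comment> \<open>Each push-forward is a probability measure, so 1 is a uniform bound on the
      masses of the kernel.\<close>
    have "emeasure (distr (FX y) (XB \<Otimes>\<^sub>M YB) (\<lambda>x. (x, y)))
        (space (distr (FX y) (XB \<Otimes>\<^sub>M YB) (\<lambda>x. (x, y)))) = 1" if "y \<in> space FY" for y
      using measurable_space[OF joint_kernel_FY that]
      by (intro prob_space.emeasure_space_1) (simp add: space_prob_algebra)
    then show "AE y in FY. emeasure (distr (FX y) (XB \<Otimes>\<^sub>M YB) (\<lambda>x. (x, y)))
        (space (distr (FX y) (XB \<Otimes>\<^sub>M YB) (\<lambda>x. (x, y)))) \<le> ennreal 1"
      by (intro AE_I2) (simp del: space_distr)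
  qed (use f bound measurable_prob_algebraD[OF joint_kernel_FY] in
        \<open>auto simp: FY.finite_measure_axioms space_pair_measure space_restrict_space\<close>)
  also have "\<dots> = (\<integral>y. (\<integral>x. f x y \<partial>FX y) \<partial>FY)"
    by (rule Bochner_Integration.integral_cong) (auto simp: space_FY integral_joint_slice[OF f])
  finally show ?thesis by simp
qed

text \<open>With \<open>a = xmin\<close> and \<open>\<phi> = 0\<close>, the null event of
  \<open>no_mass_points\<close> contains all pairs with \<open>y = 0\<close>. This disposes of the
  profitability at which the seller is indifferent between all rules.\<close>

lemma AE_profitability_nonzero: "AE y in FY. y \<noteq> 0"
proof -
  let ?S = "{(x, y) \<in> X \<times> Y. (x - xmin) * (y - 0) = 0}"
  have "{z \<in> space (XB \<Otimes>\<^sub>M YB). (fst z - xmin) * (snd z - 0) = 0} \<in> sets (XB \<Otimes>\<^sub>M YB)"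
    by measurable
  also have "{z \<in> space (XB \<Otimes>\<^sub>M YB). (fst z - xmin) * (snd z - 0) = 0} = ?S"
    by (auto simp: space_pair_measure space_restrict_space)
  finally have S: "?S \<in> sets (XB \<Otimes>\<^sub>M YB)" .
  have "J.prob ?S = 0"
    using no_mass_points[of xmin "\<lambda>_. 0"] x_nondegenerate by simp
  then have "AE z in J. z \<notin> ?S"
    using S by (subst (asm) J.prob_eq_0) (auto simp: sets_joint)
  then have "AE y in FY. AE z in distr (FX y) (XB \<Otimes>\<^sub>M YB) (\<lambda>x. (x, y)). z \<notin> ?S"
    unfolding joint_eq_bind_distr
    by (subst (asm) AE_bind[OF measurable_prob_algebraD[OF joint_kernel_FY]]) (use S in auto)
  then show ?thesis
    using AE_space
  proof eventually_elim
    case (elim y)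
    then have y: "y \<in> Y" by (simp add: space_FY)
    interpret FXy: prob_space "FX y" by (rule prob_space_FX[OF y])
    have m: "(\<lambda>x. (x, y)) \<in> FX y \<rightarrow>\<^sub>M XB \<Otimes>\<^sub>M YB"
      using y by (intro measurable_FX measurable_Pair2') (auto simp: space_restrict_space)
    have "AE x in FX y. (x, y) \<notin> ?S"
      using elim(1) by (subst (asm) AE_distr_iff[OF m]) (use S in auto)
    then have "AE x in FX y. y \<noteq> 0"
      using AE_space by eventually_elim (use y in \<open>auto simp: space_FX[OF y]\<close>)
    then show ?case by simp
  qed
qed

section \<open>Measurability and integrability of bounded functions\<close>

lemma borel_measurable_id_X: "(\<lambda>x. x) \<in> borel_measurable XB"
  by (rule measurable_restrict_space1) simp

lemma borel_measurable_diff_X [measurable]: "(\<lambda>x. x - m) \<in> borel_measurable XB"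
  by (rule measurable_restrict_space1) simp

lemma borel_measurable_p [measurable]: "p \<in> borel_measurable XB"
  by (intro borel_measurable_continuous_on_restrict differentiable_imp_continuous_on p_differentiable)

lemma p_bounds: "x \<in> X \<Longrightarrow> 0 \<le> p x \<and> p x \<le> 1"
  using p_range by (auto simp: image_subset_iff)

lemma p_deriv: "m \<in> X \<Longrightarrow> \<exists>D. (p has_real_derivative D) (at m within X)"
  using p_differentiable by (simp add: differentiable_on_def real_differentiable_def)

lemma integrable_FX:
  fixes f :: "real \<Rightarrow> real"
  assumes y: "y \<in> Y" and f: "f \<in> borel_measurable XB" and "\<And>x. x \<in> X \<Longrightarrow> \<bar>f x\<bar> \<le> B"
  shows "integrable (FX y) f"
proof -
  interpret FXy: prob_space "FX y" by (rule prob_space_FX[OF y])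
  show ?thesis
    by (rule FXy.integrable_const_bound[of _ B])
       (use assms in \<open>auto simp: space_FX[OF y] intro!: AE_I2 measurable_FX[OF y f]\<close>)
qed

lemma integrable_joint:
  fixes f :: "real \<times> real \<Rightarrow> real"
  assumes f: "f \<in> borel_measurable (XB \<Otimes>\<^sub>M YB)" and "\<And>z. z \<in> X \<times> Y \<Longrightarrow> \<bar>f z\<bar> \<le> B"
  shows "integrable J f"
proof (rule J.integrable_const_bound[of _ B])
  show "f \<in> borel_measurable J"
    using f by (simp cong: measurable_cong_sets add: sets_joint)
qed (use assms(2) in \<open>auto simp: space_joint intro!: AE_I2\<close>)

section \<open>Disclosure rules and their non-disclosure means\<close>

lemma disclosure_rule_measurable:
  "disclosure_rule X Y d \<Longrightarrow> (\<lambda>(x, y). d x y) \<in> borel_measurable (XB \<Otimes>\<^sub>M YB)"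
  by (simp add: disclosure_rule_def)

lemma disclosure_rule_range: "disclosure_rule X Y d \<Longrightarrow> x \<in> X \<Longrightarrow> y \<in> Y \<Longrightarrow> 0 \<le> d x y \<and> d x y \<le> 1"
  by (simp add: disclosure_rule_def)

lemma disclosure_rule_const: "c \<in> {0..1} \<Longrightarrow> disclosure_rule X Y (\<lambda>_ _. c)"
  by (simp add: disclosure_rule_def)

lemma disclosure_rule_slice:
  assumes "disclosure_rule X Y d" and y: "y \<in> Y"
  shows "(\<lambda>x. d x y) \<in> borel_measurable XB"
proof -
  have "(\<lambda>x. (x, y)) \<in> XB \<rightarrow>\<^sub>M XB \<Otimes>\<^sub>M YB"
    using y by (intro measurable_Pair2') (simp add: space_restrict_space)
  from measurable_compose[OF this disclosure_rule_measurable[OF assms(1)]] show ?thesis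
    by simp
qed

text \<open>Instance of \<open>weighted_mean\<close> for \<open>FX y\<close> with weight
  \<open>1 - d x y\<close>. The off-path value \<open>c\<close> is left general so that a measurable
  choice can replace \<open>c1\<close> later.\<close>

lemma nd_mean_transparent:
  assumes d: "disclosure_rule X Y d" and y: "y \<in> Y" and c: "c y \<in> X"
  defines "m \<equiv> nd_mean_transparent FX c d y"
  shows "m \<in> X" and "(\<integral>x. (1 - d x y) * (x - m) \<partial>FX y) = 0"
    and "(\<integral>x. 1 - d x y \<partial>FX y) = 0 \<Longrightarrow> AE x in FX y. 1 - d x y = 0"
proof -
  interpret FXy: prob_space "FX y" by (rule prob_space_FX[OF y])
  have w: "(\<lambda>x. 1 - d x y) \<in> borel_measurable (FX y)"
    using disclosure_rule_slice[OF d y] by (intro measurable_FX[OF y]) measurable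
  have Z: "(\<lambda>x. x) \<in> borel_measurable (FX y)"
    by (intro measurable_FX[OF y] borel_measurable_id_X)
  have m: "m = (if (\<integral>x. 1 - d x y \<partial>FX y) = 0 then c y
      else (\<integral>x. x * (1 - d x y) \<partial>FX y) / (\<integral>x. 1 - d x y \<partial>FX y))"
    by (simp add: m_def nd_mean_transparent_def Let_def)
  note wm = FXy.weighted_mean[OF w Z _ _ c m]
  show "m \<in> X" "(\<integral>x. (1 - d x y) * (x - m) \<partial>FX y) = 0"
    and "(\<integral>x. 1 - d x y \<partial>FX y) = 0 \<Longrightarrow> AE x in FX y. 1 - d x y = 0"
    using wm disclosure_rule_range[OF d _ y] by (auto simp: space_FX[OF y])
qed

text \<open>Instance of \<open>weighted_mean\<close> on the joint distribution, once
  \<open>integral_joint\<close> has turned the iterated integrals of the definition into integrals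
  over \<open>J\<close>.\<close>

lemma nd_mean_hidden:
  assumes d: "disclosure_rule X Y d"
  defines "m \<equiv> nd_mean_hidden FY FX c0 d"
  shows "m \<in> X" and "(\<integral>(x, y). (1 - d x y) * (x - m) \<partial>J) = 0"
proof -
  note [measurable] = disclosure_rule_measurable[OF d]
  have w: "(\<lambda>(x, y). 1 - d x y) \<in> borel_measurable (XB \<Otimes>\<^sub>M YB)"
    by measurable
  have wZ: "(\<lambda>(x, y). x * (1 - d x y)) \<in> borel_measurable (XB \<Otimes>\<^sub>M YB)"
    by measurable
  have "\<bar>x * (1 - d x y)\<bar> \<le> max \<bar>xmin\<bar> \<bar>xmax\<bar>" if "x \<in> X" "y \<in> Y" for x y
  proof -
    have "\<bar>x\<bar> * \<bar>1 - d x y\<bar> \<le> max \<bar>xmin\<bar> \<bar>xmax\<bar> * 1"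
      by (rule mult_mono) (use disclosure_rule_range[OF d that] that in auto)
    then show ?thesis by (simp add: abs_mult)
  qed
  note int = integral_joint[OF wZ this] integral_joint[OF w, of 1]
  have m: "m = (if (\<integral>z. 1 - d (fst z) (snd z) \<partial>J) = 0 then c0
      else (\<integral>z. fst z * (1 - d (fst z) (snd z)) \<partial>J) / (\<integral>z. 1 - d (fst z) (snd z) \<partial>J))"
    using int disclosure_rule_range[OF d] by (simp add: m_def nd_mean_hidden_def Let_def split_def)
  have "(\<lambda>z. 1 - d (fst z) (snd z)) \<in> borel_measurable J" "fst \<in> borel_measurable J"
    using w by (simp_all cong: measurable_cong_sets add: sets_joint split_def)
  note wm = J.weighted_mean[OF this _ _ c0_range m]
  show "m \<in> X" "(\<integral>(x, y). (1 - d x y) * (x - m) \<partial>J) = 0"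
    using wm disclosure_rule_range[OF d] by (auto simp: space_joint split_def)
qed

subsection \<open>Mandated transparency\<close>

text \<open>A general \<open>g\<close> of the posterior mean serves two purposes:
  \<open>g = p\<close> gives the seller's payoff at \<open>y\<close>, up to the factor
  \<open>y\<close>, and indicators give the buyer's cdf. Equality of payoffs can then be carried
  over to equality of cdfs.\<close>

definition interim :: "(real \<Rightarrow> real \<Rightarrow> real) \<Rightarrow> (real \<Rightarrow> real) \<Rightarrow> real \<Rightarrow> real" where
  "interim d g y =
     (\<integral>x. (d x y * g x + (1 - d x y) * g (nd_mean_transparent FX c1 d y)) \<partial>FX y)"

lemma seller_payoff_transparent:
  "seller_payoff FY FX p c0 c1 Mandated_Transparency d = (\<integral>y. y * interim d p y \<partial>FY)"
  by (simp add: seller_payoff_def interim_def)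

lemma buyer_cdf_transparent:
  "buyer_cdf FY FX c0 c1 d Mandated_Transparency t = (\<integral>y. interim d (indicator {..t}) y \<partial>FY)"
  by (simp add: buyer_cdf_def interim_def)

text \<open>
  \<open>c1\<close> need not be measurable, but it only matters where disclosure is almost certain, so it
  can be replaced by a constant.
\<close>

lemma borel_measurable_interim:
  assumes d: "disclosure_rule X Y d" and [measurable]: "g \<in> borel_measurable XB"
  shows "interim d g \<in> borel_measurable YB"
proof -
  define m where "m = nd_mean_transparent FX (\<lambda>_. xmin) d"
  note [measurable] = disclosure_rule_measurable[OF d]
  have "(\<lambda>y. \<integral>x. 1 - d x y \<partial>FX y) \<in> borel_measurable YB"
    "(\<lambda>y. \<integral>x. x * (1 - d x y) \<partial>FX y) \<in> borel_measurable YB"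
    by (rule borel_measurable_kernel_integral, measurable)+
  then have "m \<in> borel_measurable YB"
    unfolding m_def nd_mean_transparent_def Let_def by measurable
  moreover have m_range: "m y \<in> X" if "y \<in> Y" for y
    unfolding m_def using x_nondegenerate by (intro nd_mean_transparent(1) d that) auto
  \<comment> \<open>The function \<open>g\<close> is measurable only on \<open>XB\<close>, so
    composing it with \<open>m\<close> requires \<open>m\<close> to map into
    \<open>X\<close>.\<close>
  ultimately have [measurable]: "m \<in> YB \<rightarrow>\<^sub>M XB"
    by (intro measurable_restrict_space2) (auto simp: space_restrict_space)
  have "(\<lambda>y. \<integral>x. d x y * g x + (1 - d x y) * g (m y) \<partial>FX y) \<in> borel_measurable YB"
    by (rule borel_measurable_kernel_integral) measurable
  moreover have "(\<integral>x. d x y * g x + (1 - d x y) * g (m y) \<partial>FX y) = interim d g y" if y: "y \<in> Y" for y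
  proof (cases "(\<integral>x. 1 - d x y \<partial>FX y) = 0")
    case True
    note [measurable] = disclosure_rule_slice[OF d y]
    have "AE x in FX y. 1 - d x y = 0"
      using nd_mean_transparent(3)[OF d y _ True, of "\<lambda>_. xmin"] x_nondegenerate by simp
    then show ?thesis
      unfolding interim_def
      by (intro integral_cong_AE measurable_FX[OF y]) (measurable, use y in \<open>auto elim!: eventually_mono\<close>)
  next
    case False
    then have "m y = nd_mean_transparent FX c1 d y"
      by (simp add: m_def nd_mean_transparent_def)
    then show ?thesis by (simp add: interim_def)
  qed
  ultimately show ?thesis
    by (subst measurable_cong[symmetric]) (auto simp: space_restrict_space)
qed

lemma interim_integrand_p_bounds:
  assumes d: "disclosure_rule X Y d" and y: "y \<in> Y" and x: "x \<in> X"
  shows "d x y * p x + (1 - d x y) * p (nd_mean_transparent FX c1 d y) \<in> {0..1}"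
  using disclosure_rule_range[OF d x y] p_bounds[OF x]
    p_bounds[OF nd_mean_transparent(1)[where c = c1, OF d y c1_range[OF y]]]
  by (auto intro!: convex_bound_le)

lemma integrable_interim_p:
  assumes d: "disclosure_rule X Y d" and y: "y \<in> Y"
  shows "integrable (FX y) (\<lambda>x. d x y * p x + (1 - d x y) * p (nd_mean_transparent FX c1 d y))"
proof -
  note [measurable] = disclosure_rule_slice[OF d y]
  show ?thesis
    by (rule integrable_FX[OF y, of _ 1]) (measurable, use interim_integrand_p_bounds[OF d y] in auto)
qed

lemma integrable_nd_deviation:
  assumes d: "disclosure_rule X Y d" and y: "y \<in> Y"
  shows "integrable (FX y) (\<lambda>x. (1 - d x y) * (x - nd_mean_transparent FX c1 d y))"
proof (rule integrable_FX[OF y])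
  note [measurable] = disclosure_rule_slice[OF d y]
  show "(\<lambda>x. (1 - d x y) * (x - nd_mean_transparent FX c1 d y)) \<in> borel_measurable XB"
    by measurable
  fix x assume x: "x \<in> X"
  then show "\<bar>(1 - d x y) * (x - nd_mean_transparent FX c1 d y)\<bar> \<le> 1 * (xmax - xmin)"
    unfolding abs_mult
    using disclosure_rule_range[OF d x y] nd_mean_transparent(1)[where c = c1, OF d y c1_range[OF y]]
    by (intro mult_mono) auto
qed

lemma interim_p_bounds:
  assumes d: "disclosure_rule X Y d" and y: "y \<in> Y"
  shows "0 \<le> interim d p y" and "interim d p y \<le> 1"
proof -
  interpret FXy: prob_space "FX y" by (rule prob_space_FX[OF y])
  show "0 \<le> interim d p y" "interim d p y \<le> 1"
    using interim_integrand_p_bounds[OF d y] integrable_interim_p[OF d y]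
    by (auto simp: interim_def space_FX[OF y] intro!: integral_nonneg_AE FXy.integral_le_const AE_I2)
qed

text \<open>Optimality compares only averages over \<open>y\<close>. Here \<open>e\<close> is at
  least as good at every \<open>y\<close>, so the nonnegative gain
  \<open>y * (interim e p y - interim d p y)\<close> has integral at most zero and vanishes almost
  surely; then divide by \<open>y\<close>.\<close>

lemma optimal_interim_eq:
  assumes opt: "optimal_rule X Y FY FX p c0 c1 Mandated_Transparency d"
    and e: "disclosure_rule X Y e"
    and le: "\<And>y. y \<in> Y \<Longrightarrow> interim d p y \<le> interim e p y"
  shows "AE y in FY. interim d p y = interim e p y"
proof -
  have d: "disclosure_rule X Y d"
    using opt by (simp add: optimal_rule_def)
  have int: "integrable FY (\<lambda>y. y * interim d p y)" if d: "disclosure_rule X Y d" for d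
  proof (rule FY.integrable_const_bound[of _ ymax])
    have [measurable]: "(\<lambda>y. y) \<in> borel_measurable YB"
      by (rule measurable_restrict_space1) simp
    note [measurable] = borel_measurable_interim[OF d]
    have "(\<lambda>y. y * interim d p y) \<in> borel_measurable YB"
      by measurable
    then show "(\<lambda>y. y * interim d p y) \<in> borel_measurable FY"
      by (simp cong: measurable_cong_sets add: sets_FY)
    have "\<bar>y * interim d p y\<bar> \<le> ymax" if "y \<in> Y" for y
      using mult_mono[of y ymax "interim d p y" 1] interim_p_bounds[OF d that] that y_nonneg by simp
    then show "AE y in FY. norm (y * interim d p y) \<le> ymax"
      by (auto simp: space_FY intro!: AE_I2)
  qed
  have nonneg: "AE y in FY. 0 \<le> y * interim e p y - y * interim d p y"
    using le y_nonneg by (auto simp: space_FY intro!: AE_I2 mult_left_mono)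
  have "(\<integral>y. y * interim e p y - y * interim d p y \<partial>FY) \<le> 0"
    using opt e int[OF d] int[OF e] by (simp add: optimal_rule_def seller_payoff_transparent)
  moreover have "0 \<le> (\<integral>y. y * interim e p y - y * interim d p y \<partial>FY)"
    by (rule integral_nonneg_AE[OF nonneg])
  ultimately have "AE y in FY. y * interim e p y - y * interim d p y = 0"
    using integral_nonneg_eq_0_iff_AE[OF Bochner_Integration.integrable_diff[OF int[OF e] int[OF d]] nonneg]
    by simp
  with AE_profitability_nonzero show ?thesis
    by eventually_elim auto
qed

section \<open>Tangent bounds: full and no disclosure as interim optima\<close>

lemma interim_full_disclosure: "interim (\<lambda>_ _. 1) g y = (\<integral>x. g x \<partial>FX y)"
  by (simp add: interim_def)

lemma interim_no_disclosure: "y \<in> Y \<Longrightarrow> interim (\<lambda>_ _. 0) g y = g (\<integral>x. x \<partial>FX y)"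
  using prob_space.prob_space[OF prob_space_FX[of y]]
  by (simp add: interim_def nd_mean_transparent_def)

text \<open>Take the tangent of \<open>p\<close> at the non-disclosure mean \<open>m\<close>. Its
  linear term integrates to zero over withheld signals, so the loss against full disclosure is the
  integral of the gap \<open>s\<close> between \<open>p\<close> and the tangent. No loss means that
  almost surely \<open>x\<close> is disclosed or equals \<open>m\<close>.\<close>

lemma interim_convex:
  assumes convex: "strictly_convex_on X p" and d: "disclosure_rule X Y d" and y: "y \<in> Y"
  shows "interim d p y \<le> interim (\<lambda>_ _. 1) p y"
    and "interim d p y = interim (\<lambda>_ _. 1) p y \<Longrightarrow> g \<in> borel_measurable XB \<Longrightarrow>
           interim d g y = interim (\<lambda>_ _. 1) g y"
proof -
  note [measurable] = disclosure_rule_slice[OF d y]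
  note dr = disclosure_rule_range[OF d _ y]
  define m where "m = nd_mean_transparent FX c1 d y"
  have m: "m \<in> X" and mean: "(\<integral>x. (1 - d x y) * (x - m) \<partial>FX y) = 0"
    unfolding m_def by (intro nd_mean_transparent d y c1_range)+
  obtain D where D: "(p has_real_derivative D) (at m within X)"
    using p_deriv[OF m] by blast
  define s where "s x = (1 - d x y) * (p x - (p m + D * (x - m)))" for x
  have "0 < p x - (p m + D * (x - m))" if "x \<in> X" "x \<noteq> m" for x
    using strictly_convex_above_tangent[OF convex m that D] by simp
  then have s_nonneg: "0 \<le> s x" and s_zero: "s x = 0 \<Longrightarrow> d x y = 1 \<or> x = m" if "x \<in> X" for x
    using that dr[OF that] by (force simp: s_def)+
  have int_p: "integrable (FX y) p"
    by (rule integrable_FX[OF y, of _ 1]) (use p_bounds in auto)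
  have int_lin: "integrable (FX y) (\<lambda>x. (1 - d x y) * (x - m))"
    unfolding m_def by (rule integrable_nd_deviation[OF d y])
  have int_payoff: "integrable (FX y) (\<lambda>x. d x y * p x + (1 - d x y) * p m)"
    unfolding m_def by (rule integrable_interim_p[OF d y])
  have s_eq: "s = (\<lambda>x. (p x - (d x y * p x + (1 - d x y) * p m)) - D * ((1 - d x y) * (x - m)))"
    by (auto simp: s_def algebra_simps)
  have int_s: "integrable (FX y) s"
    unfolding s_eq using int_p int_lin int_payoff by simp
  have integral_s: "(\<integral>x. s x \<partial>FX y) = interim (\<lambda>_ _. 1) p y - interim d p y"
    unfolding s_eq interim_full_disclosure using int_p int_lin int_payoff mean
    by (simp add: interim_def m_def[symmetric])
  have AE_s: "AE x in FX y. 0 \<le> s x"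
    using s_nonneg by (auto simp: space_FX[OF y] intro!: AE_I2)
  show "interim d p y \<le> interim (\<lambda>_ _. 1) p y"
    using integral_nonneg_AE[OF AE_s] integral_s by simp
  assume "interim d p y = interim (\<lambda>_ _. 1) p y" and [measurable]: "g \<in> borel_measurable XB"
  then have "AE x in FX y. s x = 0"
    using integral_nonneg_eq_0_iff_AE[OF int_s AE_s] integral_s by simp
  \<comment> \<open>In either case, \<open>d x y = 1\<close> or \<open>x = m\<close>, the posterior
    mean is \<open>x\<close> itself.\<close>
  then have "AE x in FX y. d x y * g x + (1 - d x y) * g m = g x"
    using AE_space
  proof eventually_elim
    case (elim x)
    then show ?case
      using s_zero[of x] by (auto simp: space_FX[OF y] algebra_simps)
  qed
  then show "interim d g y = interim (\<lambda>_ _. 1) g y"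
    unfolding interim_full_disclosure unfolding interim_def m_def[symmetric]
    by (intro integral_cong_AE measurable_FX[OF y]) measurable
qed

text \<open>Now the tangent is taken at the mean \<open>\<mu>\<close> of \<open>FX y\<close>, and
  \<open>r\<close> is its height above \<open>p\<close>. The posterior mean averages to
  \<open>\<mu>\<close>, so the loss against no disclosure is the expectation of \<open>r\<close> at
  the posterior mean; it vanishes only if the posterior mean is almost surely
  \<open>\<mu>\<close>.\<close>

lemma interim_concave:
  assumes concave: "strictly_concave_on X p" and d: "disclosure_rule X Y d" and y: "y \<in> Y"
  shows "interim d p y \<le> interim (\<lambda>_ _. 0) p y"
    and "interim d p y = interim (\<lambda>_ _. 0) p y \<Longrightarrow> g \<in> borel_measurable XB \<Longrightarrow>
           interim d g y = interim (\<lambda>_ _. 0) g y"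
proof -
  interpret FXy: prob_space "FX y" by (rule prob_space_FX[OF y])
  note [measurable] = disclosure_rule_slice[OF d y]
  note dr = disclosure_rule_range[OF d _ y]
  define m where "m = nd_mean_transparent FX c1 d y"
  have m: "m \<in> X" and mean: "(\<integral>x. (1 - d x y) * (x - m) \<partial>FX y) = 0"
    unfolding m_def by (intro nd_mean_transparent d y c1_range)+
  define \<mu> where "\<mu> = (\<integral>x. x \<partial>FX y)"
  \<comment> \<open>Reading \<open>\<mu>\<close> as the mean after withholding everything yields
    \<open>\<mu> \<in> X\<close> from the general range statement.\<close>
  have "\<mu> = nd_mean_transparent FX c1 (\<lambda>_ _. 0) y"
    by (simp add: \<mu>_def nd_mean_transparent_def FXy.prob_space)
  then have \<mu>: "\<mu> \<in> X"
    using nd_mean_transparent(1)[where c = c1, OF disclosure_rule_const[of 0] y c1_range[OF y]] by simp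
  obtain D where D: "(p has_real_derivative D) (at \<mu> within X)"
    using p_deriv[OF \<mu>] by blast
  define r where "r x = p \<mu> + D * (x - \<mu>) - p x" for x
  have r_pos: "0 < r x" if "x \<in> X" "x \<noteq> \<mu>" for x
    using strictly_convex_above_tangent[OF concave[unfolded strictly_concave_on_def] \<mu> that DERIV_minus[OF D]]
    by (simp add: r_def)
  have r_nonneg: "0 \<le> r x" and r_zero: "r x = 0 \<longleftrightarrow> x = \<mu>" if "x \<in> X" for x
    using r_pos[OF that] by (cases "x = \<mu>"; force simp: r_def)+
  define s where "s x = d x y * r x + (1 - d x y) * r m" for x
  have s_nonneg: "0 \<le> s x" if "x \<in> X" for x
    using dr[OF that] r_nonneg[OF that] r_nonneg[OF m] by (simp add: s_def)
  \<comment> \<open>Both summands of \<open>s x\<close> are nonnegative, so each vanishes, and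
    \<open>r\<close> has its only zero at \<open>\<mu>\<close>.\<close>
  have s_zero: "(d x y = 0 \<or> x = \<mu>) \<and> (d x y = 1 \<or> m = \<mu>)" if "x \<in> X" "s x = 0" for x
    using dr[OF that(1)] r_nonneg[OF that(1)] r_nonneg[OF m] that(2) r_zero[OF that(1)] r_zero[OF m]
    by (auto simp: s_def add_nonneg_eq_0_iff)
  have int_x: "integrable (FX y) (\<lambda>x. x)"
    by (rule integrable_FX[OF y borel_measurable_id_X, of "max \<bar>xmin\<bar> \<bar>xmax\<bar>"]) auto
  have int_lin: "integrable (FX y) (\<lambda>x. (1 - d x y) * (x - m))"
    unfolding m_def by (rule integrable_nd_deviation[OF d y])
  have int_payoff: "integrable (FX y) (\<lambda>x. d x y * p x + (1 - d x y) * p m)"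
    unfolding m_def by (rule integrable_interim_p[OF d y])
  \<comment> \<open>The deviation of the posterior mean from \<open>\<mu>\<close>,
    \<open>d x y * (x - \<mu>) + (1 - d x y) * (m - \<mu>)\<close>, is rewritten as a difference of
    two terms that each integrate to zero.\<close>
  have s_eq: "s = (\<lambda>x. (p \<mu> - (d x y * p x + (1 - d x y) * p m)) +
      D * ((x - \<mu>) - (1 - d x y) * (x - m)))"
    by (auto simp: s_def r_def algebra_simps)
  have int_s: "integrable (FX y) s"
    unfolding s_eq using int_x int_lin int_payoff by simp
  have integral_s: "(\<integral>x. s x \<partial>FX y) = interim (\<lambda>_ _. 0) p y - interim d p y"
    unfolding s_eq interim_no_disclosure[OF y] using int_x int_lin int_payoff mean
    by (simp add: interim_def m_def[symmetric] \<mu>_def[symmetric] FXy.prob_space)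
  have AE_s: "AE x in FX y. 0 \<le> s x"
    using s_nonneg by (auto simp: space_FX[OF y] intro!: AE_I2)
  show "interim d p y \<le> interim (\<lambda>_ _. 0) p y"
    using integral_nonneg_AE[OF AE_s] integral_s by simp
  assume "interim d p y = interim (\<lambda>_ _. 0) p y" and [measurable]: "g \<in> borel_measurable XB"
  then have "AE x in FX y. s x = 0"
    using integral_nonneg_eq_0_iff_AE[OF int_s AE_s] integral_s by simp
  then have "AE x in FX y. d x y * g x + (1 - d x y) * g m = g \<mu>"
    using AE_space
  proof eventually_elim
    case (elim x)
    then show ?case
      using s_zero[of x] by (auto simp: space_FX[OF y] algebra_simps)
  qed
  then have "interim d g y = (\<integral>x. g \<mu> \<partial>FX y)"
    unfolding interim_def m_def[symmetric]
    by (intro integral_cong_AE measurable_FX[OF y]) measurable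
  then show "interim d g y = interim (\<lambda>_ _. 0) g y"
    by (simp add: interim_no_disclosure[OF y] \<mu>_def FXy.prob_space)
qed

text \<open>Common last step of both cases, with \<open>e\<close> full or no disclosure: payoffs
  agree for almost every \<open>y\<close>, and there \<open>eq\<close> passes the agreement on to
  the indicator of \<open>{..t}\<close>.\<close>

lemma buyer_cdf_optimal_eq:
  assumes opt: "optimal_rule X Y FY FX p c0 c1 Mandated_Transparency d"
    and e: "disclosure_rule X Y e"
    and le: "\<And>y. y \<in> Y \<Longrightarrow> interim d p y \<le> interim e p y"
    and eq: "\<And>y g. y \<in> Y \<Longrightarrow> interim d p y = interim e p y \<Longrightarrow> g \<in> borel_measurable XB \<Longrightarrow>
               interim d g y = interim e g y"
  shows "buyer_cdf FY FX c0 c1 d Mandated_Transparency t = buyer_cdf FY FX c0 c1 e Mandated_Transparency t"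
proof -
  have d: "disclosure_rule X Y d"
    using opt by (simp add: optimal_rule_def)
  have ind: "(indicator {..t} :: real \<Rightarrow> real) \<in> borel_measurable XB"
    by (rule measurable_restrict_space1) simp
  have "AE y in FY. interim d p y = interim e p y"
    by (rule optimal_interim_eq[OF opt e le])
  then have "AE y in FY. interim d (indicator {..t}) y = interim e (indicator {..t}) y"
    using AE_space
    by eventually_elim (use eq ind in \<open>auto simp: space_FY\<close>)
  then show ?thesis
    unfolding buyer_cdf_transparent using borel_measurable_interim[OF d ind] borel_measurable_interim[OF e ind]
    by (intro integral_cong_AE) (auto cong: measurable_cong_sets simp: sets_FY)
qed

subsection \<open>Hidden motives\<close>

text \<open>Expectation of the convex function \<open>max 0 (t - \<cdot>)\<close> of the buyer's
  posterior mean. As the integrated cdf, it is the quantity compared in a mean-preserving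
  spread.\<close>

definition mean_shortfall :: "(real \<Rightarrow> real \<Rightarrow> real) \<Rightarrow> real \<Rightarrow> real" where
  "mean_shortfall d t = (\<integral>(x, y). (d x y * max 0 (t - x)
      + (1 - d x y) * max 0 (t - nd_mean_hidden FY FX c0 d)) \<partial>J)"

lemma integrable_rule_mult:
  assumes d: "disclosure_rule X Y d"
    and f: "f \<in> borel_measurable XB" "\<And>x. x \<in> X \<Longrightarrow> \<bar>f x\<bar> \<le> B"
  shows "integrable J (\<lambda>(x, y). d x y * f x)" and "integrable J (\<lambda>(x, y). (1 - d x y) * f x)"
proof -
  note [measurable] = disclosure_rule_measurable[OF d] f(1)
  have bound: "\<bar>w * f x\<bar> \<le> B" if "0 \<le> w" "w \<le> 1" "x \<in> X" for w x
    using mult_mono[of "\<bar>w\<bar>" 1 "\<bar>f x\<bar>" B] f(2)[OF that(3)] that by (simp add: abs_mult)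
  show "integrable J (\<lambda>(x, y). d x y * f x)" "integrable J (\<lambda>(x, y). (1 - d x y) * f x)"
    by (rule integrable_joint[of _ B], measurable, use bound disclosure_rule_range[OF d] in auto)+
qed

lemma integrable_shortfall:
  assumes d: "disclosure_rule X Y d"
  shows "integrable J (\<lambda>(x, y). d x y * max 0 (t - x))"
    and "integrable J (\<lambda>(x, y). (1 - d x y) * max 0 (t - x))"
    and "integrable J (\<lambda>(x, y). (1 - d x y) * max 0 (t - m))"
    and "integrable J (\<lambda>(x, y). d x y * (t - x))"
    and "integrable J (\<lambda>(x, y). (1 - d x y) * (t - x))"
    and "integrable J (\<lambda>(x, y). (1 - d x y) * (t - m))"
proof -
  have [measurable]: "(\<lambda>x. t - x) \<in> borel_measurable XB"
    by (rule measurable_restrict_space1) simp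
  have max: "(\<lambda>x. max 0 (t - x)) \<in> borel_measurable XB"
    by measurable
  show "integrable J (\<lambda>(x, y). d x y * max 0 (t - x))"
    "integrable J (\<lambda>(x, y). (1 - d x y) * max 0 (t - x))"
    by (rule integrable_rule_mult[OF d max, of "\<bar>t - xmin\<bar>"], force)+
  show "integrable J (\<lambda>(x, y). d x y * (t - x))"
    "integrable J (\<lambda>(x, y). (1 - d x y) * (t - x))"
    by (rule integrable_rule_mult[OF d, of "\<lambda>x. t - x" "\<bar>t - xmin\<bar> + \<bar>t - xmax\<bar>"], measurable, force)+
  show "integrable J (\<lambda>(x, y). (1 - d x y) * max 0 (t - m))"
    by (rule integrable_rule_mult(2)[OF d, of "\<lambda>_. max 0 (t - m)" "max 0 (t - m)"]) auto
  show "integrable J (\<lambda>(x, y). (1 - d x y) * (t - m))"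
    by (rule integrable_rule_mult(2)[OF d, of "\<lambda>_. t - m" "\<bar>t - m\<bar>"]) auto
qed

text \<open>Pooling preserves expectations of affine functions: the two integrands differ by
  \<open>(1 - d x y) * (x - m)\<close>, which integrates to zero.\<close>

lemma integral_nd_shift:
  assumes d: "disclosure_rule X Y d"
  shows "(\<integral>(x, y). (1 - d x y) * (t - nd_mean_hidden FY FX c0 d) \<partial>J) = (\<integral>(x, y). (1 - d x y) * (t - x) \<partial>J)"
proof -
  define m where "m = nd_mean_hidden FY FX c0 d"
  have "(\<lambda>(x, y). (1 - d x y) * (x - m)) = (\<lambda>z. (\<lambda>(x, y). (1 - d x y) * (t - m)) z - (\<lambda>(x, y). (1 - d x y) * (t - x)) z)"
    by (auto simp: algebra_simps)
  then have "(\<integral>(x, y). (1 - d x y) * (x - m) \<partial>J)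
      = (\<integral>(x, y). (1 - d x y) * (t - m) \<partial>J) - (\<integral>(x, y). (1 - d x y) * (t - x) \<partial>J)"
    using integrable_shortfall(5,6)[OF d] by (simp only: Bochner_Integration.integral_diff)
  then show ?thesis
    using nd_mean_hidden(2)[OF d] by (simp add: m_def)
qed

text \<open>Split the cdf into a disclosed part, with weight \<open>d\<close> at \<open>x\<close>,
  and a pooled part, with weight \<open>1 - d\<close> at the constant \<open>m\<close>, and apply
  \<open>has_integral_weighted_cdf\<close> to each.\<close>

lemma has_integral_buyer_cdf_hidden:
  assumes d: "disclosure_rule X Y d"
  shows "(buyer_cdf FY FX c0 c1 d Hidden_Motives has_integral mean_shortfall d t) {xmin..t}"
proof -
  define m where "m = nd_mean_hidden FY FX c0 d"
  have m: "m \<in> X"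
    unfolding m_def by (rule nd_mean_hidden(1)[OF d])
  note [measurable] = disclosure_rule_measurable[OF d]
  have w: "(\<lambda>(x, y). d x y) \<in> borel_measurable J" "(\<lambda>(x, y). 1 - d x y) \<in> borel_measurable J"
    "fst \<in> borel_measurable J"
    by measurable
  have ind: "(indicator {..s} :: real \<Rightarrow> real) \<in> borel_measurable XB" for s
    by (rule measurable_restrict_space1) simp
  have "buyer_cdf FY FX c0 c1 d Hidden_Motives =
      (\<lambda>s. (\<integral>z. (\<lambda>(x, y). d x y) z * indicator {..s} (fst z) \<partial>J)
      + (\<integral>z. (\<lambda>(x, y). 1 - d x y) z * indicator {..s} m \<partial>J))"
  proof
    fix s
    note [measurable] = ind[of s]
    have "buyer_cdf FY FX c0 c1 d Hidden_Motives s
        = (\<integral>(x, y). d x y * indicator {..s} x + (1 - d x y) * indicator {..s} m \<partial>J)"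
      unfolding buyer_cdf_def nd_mean.simps m_def[symmetric]
    proof (rule integral_joint[where B = 1])
      fix x y assume "x \<in> X" "y \<in> Y"
      then show "\<bar>d x y * indicator {..s} x + (1 - d x y) * indicator {..s} m\<bar> \<le> 1"
        using disclosure_rule_range[OF d, of x y] by (simp add: indicator_def)
    qed measurable
    also have "\<dots> = (\<integral>z. (\<lambda>(x, y). d x y * indicator {..s} x) z
        + (\<lambda>(x, y). (1 - d x y) * indicator {..s} m) z \<partial>J)"
      by (simp add: split_def)
    also have "\<dots> = (\<integral>(x, y). d x y * indicator {..s} x \<partial>J) + (\<integral>(x, y). (1 - d x y) * indicator {..s} m \<partial>J)"
      using integrable_rule_mult(1)[OF d ind[of s], of 1]
        integrable_rule_mult(2)[OF d, of "\<lambda>_. indicator {..s} m" 1]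
      by (intro Bochner_Integration.integral_add) (auto simp: indicator_def)
    finally show "buyer_cdf FY FX c0 c1 d Hidden_Motives s =
        (\<integral>z. (\<lambda>(x, y). d x y) z * indicator {..s} (fst z) \<partial>J)
        + (\<integral>z. (\<lambda>(x, y). 1 - d x y) z * indicator {..s} m \<partial>J)"
      by (simp add: split_def)
  qed
  moreover have "mean_shortfall d t =
      (\<integral>z. (\<lambda>(x, y). d x y) z * max 0 (t - fst z) \<partial>J) + (\<integral>z. (\<lambda>(x, y). 1 - d x y) z * max 0 (t - m) \<partial>J)"
    using integrable_shortfall(1,3)[OF d] unfolding mean_shortfall_def m_def[symmetric] split_def
    by (rule Bochner_Integration.integral_add)
  ultimately show ?thesis
    using disclosure_rule_range[OF d] m
    by (simp only:) (intro has_integral_add J.has_integral_weighted_cdf w; force simp: space_joint)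
qed

section \<open>Full and no disclosure as extremes of the spread order\<close>

lemma mean_shortfall_full_disclosure: "mean_shortfall (\<lambda>_ _. 1) t = (\<integral>z. max 0 (t - fst z) \<partial>J)"
  by (simp add: mean_shortfall_def split_def)

text \<open>The off-path value does not enter because the denominator is one. The left-hand side
  stands for the prior mean in what follows.\<close>

lemma nd_mean_hidden_no_disclosure: "nd_mean_hidden FY FX c0 (\<lambda>_ _. 0) = (\<integral>y. (\<integral>x. x \<partial>FX y) \<partial>FY)"
proof -
  have "(\<integral>y. measure (FX y) (space (FX y)) \<partial>FY) = (\<integral>y. 1 \<partial>FY)"
    by (rule Bochner_Integration.integral_cong) (auto simp: space_FY prob_space.prob_space[OF prob_space_FX])
  then show ?thesis
    by (simp add: nd_mean_hidden_def FY.prob_space)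
qed

lemma mean_shortfall_no_disclosure: "mean_shortfall (\<lambda>_ _. 0) t = max 0 (t - nd_mean_hidden FY FX c0 (\<lambda>_ _. 0))"
  by (simp add: mean_shortfall_def split_def J.prob_space)

text \<open>Jensen's inequality on the withheld signals: the pooled shortfall is zero if
  \<open>t \<le> m\<close>, and otherwise it is affine, so that \<open>m\<close> may be replaced by
  \<open>x\<close> before bounding \<open>t - x\<close> by its positive part.\<close>

lemma mean_shortfall_le_full_disclosure:
  assumes d: "disclosure_rule X Y d"
  shows "mean_shortfall d t \<le> mean_shortfall (\<lambda>_ _. 1) t"
proof -
  define m where "m = nd_mean_hidden FY FX c0 d"
  have "(\<integral>(x, y). (1 - d x y) * max 0 (t - m) \<partial>J) \<le> (\<integral>(x, y). (1 - d x y) * max 0 (t - x) \<partial>J)"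
  proof (cases "t \<le> m")
    case True
    then show ?thesis
      using disclosure_rule_range[OF d]
      by (auto simp: split_def max_def space_joint intro!: integral_nonneg_AE AE_I2)
  next
    case False
    then have "(\<integral>(x, y). (1 - d x y) * max 0 (t - m) \<partial>J) = (\<integral>(x, y). (1 - d x y) * (t - x) \<partial>J)"
      using integral_nd_shift[OF d, of t] by (simp add: m_def max_def)
    also have "\<dots> \<le> (\<integral>(x, y). (1 - d x y) * max 0 (t - x) \<partial>J)"
      by (intro integral_mono integrable_shortfall[OF d])
         (use disclosure_rule_range[OF d] in \<open>auto simp: space_joint intro!: mult_left_mono\<close>)
    finally show ?thesis .
  qed
  then have "mean_shortfall d t \<le> (\<integral>(x, y). d x y * max 0 (t - x) \<partial>J) + (\<integral>(x, y). (1 - d x y) * max 0 (t - x) \<partial>J)"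
    using integrable_shortfall(1,3)[OF d, of t] by (simp add: mean_shortfall_def m_def[symmetric] split_def)
  also have "\<dots> = (\<integral>z. d (fst z) (snd z) * max 0 (t - fst z) + (1 - d (fst z) (snd z)) * max 0 (t - fst z) \<partial>J)"
    using integrable_shortfall(1,2)[OF d, of t] unfolding split_def
    by (rule Bochner_Integration.integral_add[symmetric])
  also have "\<dots> = mean_shortfall (\<lambda>_ _. 1) t"
    unfolding mean_shortfall_full_disclosure by (simp add: algebra_simps)
  finally show ?thesis .
qed

text \<open>Iterated expectations: the posterior mean averages to the prior mean.
  \<open>integral_nd_shift\<close> is used for \<open>d\<close>, and for no disclosure to identify
  the prior mean.\<close>

lemma integral_posterior_hidden:
  assumes d: "disclosure_rule X Y d"
  shows "(\<integral>(x, y). d x y * (t - x) \<partial>J) + (\<integral>(x, y). (1 - d x y) * (t - nd_mean_hidden FY FX c0 d) \<partial>J)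
    = t - nd_mean_hidden FY FX c0 (\<lambda>_ _. 0)"
proof -
  have "(\<integral>(x, y). d x y * (t - x) \<partial>J) + (\<integral>(x, y). (1 - d x y) * (t - x) \<partial>J)
    = (\<integral>z. d (fst z) (snd z) * (t - fst z) + (1 - d (fst z) (snd z)) * (t - fst z) \<partial>J)"
    using integrable_shortfall(4,5)[OF d, of t] unfolding split_def
    by (rule Bochner_Integration.integral_add[symmetric])
  also have "\<dots> = (\<integral>z. t - fst z \<partial>J)"
    by (simp add: algebra_simps)
  also have "\<dots> = (\<integral>z. t - nd_mean_hidden FY FX c0 (\<lambda>_ _. 0) \<partial>J)"
    using integral_nd_shift[OF disclosure_rule_const[of 0], of t] by (simp add: split_def)
  finally show ?thesis
    using integral_nd_shift[OF d] by (simp add: J.prob_space)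
qed

text \<open>Jensen's inequality for the whole posterior mean: the shortfall is at least 0 and at
  least \<open>t\<close> minus the posterior mean, whose expectation is the same for every
  rule.\<close>

lemma mean_shortfall_ge_no_disclosure:
  assumes d: "disclosure_rule X Y d"
  shows "mean_shortfall (\<lambda>_ _. 0) t \<le> mean_shortfall d t"
proof -
  define m where "m = nd_mean_hidden FY FX c0 d"
  have "0 \<le> mean_shortfall d t"
    unfolding mean_shortfall_def using disclosure_rule_range[OF d]
    by (intro integral_nonneg_AE AE_I2) (auto simp: space_joint)
  moreover have "t - nd_mean_hidden FY FX c0 (\<lambda>_ _. 0) \<le> mean_shortfall d t"
  proof -
    have "(\<integral>(x, y). d x y * (t - x) \<partial>J) \<le> (\<integral>(x, y). d x y * max 0 (t - x) \<partial>J)"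
      "(\<integral>(x, y). (1 - d x y) * (t - m) \<partial>J) \<le> (\<integral>(x, y). (1 - d x y) * max 0 (t - m) \<partial>J)"
      by (intro integral_mono integrable_shortfall[OF d];
          use disclosure_rule_range[OF d] in \<open>auto simp: space_joint intro!: mult_left_mono\<close>)+
    moreover have "mean_shortfall d t =
        (\<integral>(x, y). d x y * max 0 (t - x) \<partial>J) + (\<integral>(x, y). (1 - d x y) * max 0 (t - m) \<partial>J)"
      using integrable_shortfall(1,3)[OF d] unfolding mean_shortfall_def m_def[symmetric] split_def
      by (rule Bochner_Integration.integral_add)
    ultimately show ?thesis
      using integral_posterior_hidden[OF d, of t] by (simp add: m_def)
  qed
  ultimately show ?thesis
    by (simp add: mean_shortfall_no_disclosure)
qed

text \<open>No posterior mean exceeds \<open>xmax\<close>, so the positive part drops out and an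
  affine expectation remains. Its value is independent of the rule, which gives the equal-means half
  of a mean-preserving spread.\<close>

lemma mean_shortfall_top:
  assumes d: "disclosure_rule X Y d"
  shows "mean_shortfall d xmax = xmax - nd_mean_hidden FY FX c0 (\<lambda>_ _. 0)"
proof -
  define m where "m = nd_mean_hidden FY FX c0 d"
  have "m \<le> xmax"
    using nd_mean_hidden(1)[OF d] by (simp add: m_def)
  then have "mean_shortfall d xmax = (\<integral>z. (\<lambda>(x, y). d x y * (xmax - x)) z + (\<lambda>(x, y). (1 - d x y) * (xmax - m)) z \<partial>J)"
    unfolding mean_shortfall_def m_def[symmetric]
    by (intro Bochner_Integration.integral_cong) (auto simp: space_joint)
  also have "\<dots> = xmax - nd_mean_hidden FY FX c0 (\<lambda>_ _. 0)"
    using integral_posterior_hidden[OF d, of xmax] integrable_shortfall(4,6)[OF d] by (simp add: m_def)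
  finally show ?thesis .
qed

lemma better_informed_hidden:
  assumes "disclosure_rule X Y d" "disclosure_rule X Y e" "\<And>t. mean_shortfall e t \<le> mean_shortfall d t"
  shows "better_informed xmin xmax FY FX c0 c1 (d, Hidden_Motives) (e, Hidden_Motives)"
  using assms has_integral_buyer_cdf_hidden[THEN integral_unique] mean_shortfall_top
  by (simp add: better_informed_def mean_preserving_spread_def)

lemma better_informed_full_disclosure:
  assumes "disclosure_rule X Y d"
  shows "better_informed xmin xmax FY FX c0 c1 (\<lambda>_ _. 1, Hidden_Motives) (d, Hidden_Motives)"
  using assms mean_shortfall_le_full_disclosure by (intro better_informed_hidden disclosure_rule_const) auto

lemma better_informed_no_disclosure:
  assumes "disclosure_rule X Y d"
  shows "better_informed xmin xmax FY FX c0 c1 (d, Hidden_Motives) (\<lambda>_ _. 0, Hidden_Motives)"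
  using assms mean_shortfall_ge_no_disclosure by (intro better_informed_hidden disclosure_rule_const) auto

text \<open>The non-disclosure mean gets weight zero, so the regime does not matter. This moves the
  comparison entirely into the hidden motives environment.\<close>

lemma buyer_cdf_full_disclosure:
  "buyer_cdf FY FX c0 c1 (\<lambda>_ _. 1) Mandated_Transparency = buyer_cdf FY FX c0 c1 (\<lambda>_ _. 1) Hidden_Motives"
  by (simp add: buyer_cdf_def fun_eq_iff)

text \<open>If all conditional means agree, observing \<open>y\<close> alone tells the buyer nothing
  about \<open>x\<close> on average: the posterior mean is the prior mean in both regimes.\<close>

lemma buyer_cdf_no_disclosure:
  assumes mean: "\<forall>y\<in>Y. (\<integral>x. x \<partial>FX y) = (\<integral>y'. (\<integral>x. x \<partial>FX y') \<partial>FY)"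
  shows "buyer_cdf FY FX c0 c1 (\<lambda>_ _. 0) Mandated_Transparency = buyer_cdf FY FX c0 c1 (\<lambda>_ _. 0) Hidden_Motives"
proof -
  have "nd_mean_transparent FX c1 (\<lambda>_ _. 0) y = nd_mean_hidden FY FX c0 (\<lambda>_ _. 0)" if "y \<in> Y" for y
    using mean that prob_space.prob_space[OF prob_space_FX[OF that]]
    unfolding nd_mean_hidden_no_disclosure by (simp add: nd_mean_transparent_def)
  then show ?thesis
    unfolding buyer_cdf_def nd_mean.simps
    by (intro ext Bochner_Integration.integral_cong refl) (simp add: space_FY)
qed

end

theorem corollary3:
  fixes xmin xmax ymin ymax :: real
    and FY :: "real measure" and FX :: "real \<Rightarrow> real measure"
    and p :: "real \<Rightarrow> real"
    and c0 :: real and c1 :: "real \<Rightarrow> real"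
    and d d' :: "real \<Rightarrow> real \<Rightarrow> real"
  assumes setting: "disclosure_setting xmin xmax ymin ymax FY FX p c0 c1"
    and d_optimal: "optimal_rule {xmin..xmax} {ymin..ymax} FY FX p c0 c1 Mandated_Transparency d"
    and d'_optimal: "optimal_rule {xmin..xmax} {ymin..ymax} FY FX p c0 c1 Hidden_Motives d'"
  shows "(strictly_convex_on {xmin..xmax} p \<longrightarrow>
            better_informed xmin xmax FY FX c0 c1 (d, Mandated_Transparency) (d', Hidden_Motives)) \<and>
         (strictly_concave_on {xmin..xmax} p \<and>
          (\<forall>y\<in>{ymin..ymax}. (\<integral>x. x \<partial>FX y) = (\<integral>y'. (\<integral>x. x \<partial>FX y') \<partial>FY)) \<longrightarrow>
            better_informed xmin xmax FY FX c0 c1 (d', Hidden_Motives) (d, Mandated_Transparency))"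
proof -
  interpret disclosure_setting xmin xmax ymin ymax FY FX p c0 c1
    by (rule setting)
  have d: "disclosure_rule X Y d" and d': "disclosure_rule X Y d'"
    using d_optimal d'_optimal by (simp_all add: optimal_rule_def)
  show ?thesis
  proof (intro conjI impI)
    assume "strictly_convex_on X p"
    note convex = interim_convex[OF this d]
    \<comment> \<open>By uniqueness of the interim optimum, \<open>d\<close> induces the cdf of full
      disclosure, the largest in the spread order.\<close>
    have "buyer_cdf FY FX c0 c1 d Mandated_Transparency = buyer_cdf FY FX c0 c1 (\<lambda>_ _. 1) Hidden_Motives"
      unfolding buyer_cdf_full_disclosure[symmetric]
      by (rule ext, rule buyer_cdf_optimal_eq[OF d_optimal disclosure_rule_const convex]) auto
    then show "better_informed xmin xmax FY FX c0 c1 (d, Mandated_Transparency) (d', Hidden_Motives)"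
      using better_informed_full_disclosure[OF d'] by (simp add: better_informed_def)
  next
    assume A: "strictly_concave_on X p \<and> (\<forall>y\<in>Y. (\<integral>x. x \<partial>FX y) = (\<integral>y'. (\<integral>x. x \<partial>FX y') \<partial>FY))"
    note concave = interim_concave[OF conjunct1[OF A] d]
    \<comment> \<open>Here \<open>d\<close> induces the cdf of no disclosure; equality of the
      conditional means makes it degenerate at the prior mean, the smallest in the spread
      order.\<close>
    have "buyer_cdf FY FX c0 c1 d Mandated_Transparency = buyer_cdf FY FX c0 c1 (\<lambda>_ _. 0) Hidden_Motives"
      unfolding buyer_cdf_no_disclosure[OF conjunct2[OF A], symmetric]
      by (rule ext, rule buyer_cdf_optimal_eq[OF d_optimal disclosure_rule_const concave]) auto
    then show "better_informed xmin xmax FY FX c0 c1 (d', Hidden_Motives) (d, Mandated_Transparency)"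
      using better_informed_no_disclosure[OF d'] by (simp add: better_informed_def)
  qed
qed

end
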